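(* Let $f$ be a completely reducible $n$-ary quasigroup of order $q$. \begin{enumerate} \item If $n$ is odd, then $f$ has at least $(q\cdot q!)^{\frac{n-1}{2}}$ transversals. \item If $n$ is even and the external quasigroup of at least one proper representation of $f$ has a transversal, then $f$ has at least $(q\cdot q!)^{\lfloor \frac{n-1}{2}\rfloor}$ transversals. \end{enumerate}
   Context: Let $\Sigma_q=\{0,\dots,q-1\}$. An $n$-ary quasigroup of order $q$ is a map $f:\Sigma_q^n\to\Sigma_q$ such that the equation $x_0=f(x_1,\dots,x_n)$ has a unique solution in any one of the variables $x_0,\dots,x_n$ when the other $n$ variables are fixed arbitrarily. A transversal in $f$ is a set of $q$ vectors $\alpha^i=(a^i_0,\dots,a^i_n)\in\Sigma_q^{n+1}$, $i=1,\dots,q$, such that $a^i_0=f(a^i_1,\dots,a^i_n)$ for all $i$ and $a^i_k\neq a^j_k$ for all $i\neq j$ and all $k\in\{0,\dots,n\}$. An $n$-ary quasigroup $f$ is a composition of an $(n-m)$-ary quasigroup $h$ and an $(m+1)$-ary quasigroup $g$ (all of order $q$) if there is a permutation $\sigma$ of $\{0,\dots,n\}$ such that for all $x_0,\dots,x_n\in\Sigma_q$: $f(x_1,\dots,x_n)=x_0 \iff g(x_{\sigma(0)},\dots,x_{\sigma(m)})=h(x_{\sigma(m+1)},\dots,x_{\sigma(n)})$. All binary quasigroups are completely reducible; for $n\ge 3$, an $n$-ary quasigroup is completely reducible if it is a composition of two completely reducible quasigroups each of arity at least $2$. A proper representation of an $n$-ary quasigroup $f$ consists of a permutation $\pi$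 of $\{0,\dots,n\}$, a completely reducible $(n-1)$-ary quasigroup $h_1$ and a binary quasigroup $h_2$ (all of order $q$) such that for all $x_0,\dots,x_n\in\Sigma_q$: $x_0=f(x_1,\dots,x_n)\iff h_1(x_{\pi(0)},\dots,x_{\pi(n-2)})=h_2(x_{\pi(n-1)},x_{\pi(n)})$; the binary quasigroup $h_2$ is called the external quasigroup of this proper representation. *)

theory Defs
  imports "HOL-Combinatorics.Permutations"
begin

text \<open>Elements of \<open>\<Sigma>\<^sub>q\<^sup>n\<close> are lists of length \<open>n\<close> with entries below \<open>q\<close>.
  A tuple \<open>(x\<^sub>0, x\<^sub>1, \<dots>, x\<^sub>n)\<close> is a list \<open>x\<close> of length \<open>n + 1\<close>, so that
  \<open>x\<^sub>0 = f(x\<^sub>1, \<dots>, x\<^sub>n)\<close> reads \<open>x ! 0 = f (tl x)\<close>. Values of \<open>f\<close> on lists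
  outside \<open>\<Sigma>\<^sub>q\<^sup>n\<close> are irrelevant.\<close>

definition vecs :: "nat \<Rightarrow> nat \<Rightarrow> nat list set" where
  "vecs q n = {x. length x = n \<and> set x \<subseteq> {..<q}}"

definition quasigroup :: "nat \<Rightarrow> nat \<Rightarrow> (nat list \<Rightarrow> nat) \<Rightarrow> bool" where
  "quasigroup q n f \<longleftrightarrow>
     (\<forall>y\<in>vecs q n. f y < q) \<and>
     (\<forall>x\<in>vecs q (n + 1). \<forall>k\<le>n. \<exists>!a. a < q \<and> (x[k := a]) ! 0 = f (tl (x[k := a])))"

definition transversal :: "nat \<Rightarrow> nat \<Rightarrow> (nat list \<Rightarrow> nat) \<Rightarrow> nat list set \<Rightarrow> bool" where
  "transversal q n f T \<longleftrightarrow>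
     T \<subseteq> vecs q (n + 1) \<and> card T = q \<and>
     (\<forall>x\<in>T. x ! 0 = f (tl x)) \<and>
     (\<forall>x\<in>T. \<forall>y\<in>T. x \<noteq> y \<longrightarrow> (\<forall>k\<le>n. x ! k \<noteq> y ! k))"

text \<open>Here \<open>g\<close> takes the \<open>m + 1\<close> arguments with positions \<open>\<sigma> 0, \<dots>, \<sigma> m\<close>, and
  \<open>h\<close> takes the \<open>n - m\<close> arguments with positions \<open>\<sigma> (m + 1), \<dots>, \<sigma> n\<close>.\<close>

definition composition ::
  "nat \<Rightarrow> nat \<Rightarrow> nat \<Rightarrow> (nat list \<Rightarrow> nat) \<Rightarrow> (nat list \<Rightarrow> nat) \<Rightarrow> (nat list \<Rightarrow> nat) \<Rightarrow> bool" where
  "composition q n m f h g \<longleftrightarrow>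
     m \<le> n \<and> quasigroup q n f \<and> quasigroup q (n - m) h \<and> quasigroup q (m + 1) g \<and>
     (\<exists>\<sigma>. \<sigma> permutes {0..n} \<and>
        (\<forall>x\<in>vecs q (n + 1).
           f (tl x) = x ! 0 \<longleftrightarrow>
           g (map (\<lambda>i. x ! \<sigma> i) [0..<m + 1]) = h (map (\<lambda>i. x ! \<sigma> i) [m + 1..<n + 1])))"

inductive completely_reducible :: "nat \<Rightarrow> nat \<Rightarrow> (nat list \<Rightarrow> nat) \<Rightarrow> bool" for q where
  binary: "quasigroup q 2 f \<Longrightarrow> completely_reducible q 2 f"
| compose: "\<lbrakk>n \<ge> 3; quasigroup q n f; composition q n m f h g; n - m \<ge> 2; m + 1 \<ge> 2;
     completely_reducible q (n - m) h; completely_reducible q (m + 1) g\<rbrakk>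
     \<Longrightarrow> completely_reducible q n f"

lemma completely_reducible_imp_quasigroup:
  "completely_reducible q n f \<Longrightarrow> quasigroup q n f"
  by (induction rule: completely_reducible.induct) auto

lemma completely_reducible_arity:
  "completely_reducible q n f \<Longrightarrow> n \<ge> 2"
  by (induction rule: completely_reducible.induct) auto

text \<open>The last argument \<open>h2\<close> is the external quasigroup of the representation.\<close>

definition proper_representation ::
  "nat \<Rightarrow> nat \<Rightarrow> (nat list \<Rightarrow> nat) \<Rightarrow> (nat \<Rightarrow> nat) \<Rightarrow> (nat list \<Rightarrow> nat) \<Rightarrow> (nat list \<Rightarrow> nat) \<Rightarrow> bool" where
  "proper_representation q n f \<pi> h1 h2 \<longleftrightarrow>
     quasigroup q n f \<and> \<pi> permutes {0..n} \<and>
     completely_reducible q (n - 1) h1 \<and> quasigroup q 2 h2 \<and>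
     (\<forall>x\<in>vecs q (n + 1).
        x ! 0 = f (tl x) \<longleftrightarrow>
        h1 (map (\<lambda>i. x ! \<pi> i) [0..<n - 1]) = h2 [x ! \<pi> (n - 1), x ! \<pi> n])"

end

theory Submission
  imports Defs
begin

text \<open>
  A completely reducible quasigroup is given by a tree of binary quasigroups whose leaves are the
  variables, and any variable may be chosen as the root, so that the relation
  \<open>x\<^sub>0 = f(x\<^sub>1, \<dots>, x\<^sub>n)\<close> becomes \<open>x\<^sub>z = E(x)\<close> for a read-once expression \<open>E\<close>.
  Let each of the \<open>k\<close> variables of such an expression run through a permutation of
  \<open>\<Sigma>\<^sub>q\<close>, the \<open>q\<close> arguments being indexed by \<open>i < q\<close>. By structural
  induction: if \<open>k\<close> is odd, the values of \<open>E\<close> form a prescribed permutation in at least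
  \<open>(q q!)\<^bsup>(k-1)/2\<^esup>\<close> ways; if \<open>k\<close> is even, they are all equal to a prescribed
  constant in at least \<open>q! (q q!)\<^bsup>(k-2)/2\<^esup>\<close> ways. At a node with two odd children the
  permutation of one child is free (\<open>q!\<close> choices) and determines that of the other; at a node
  with an even child the constant of that child is free (\<open>q\<close> choices).
  For even \<open>n\<close>, the values of \<open>h\<^sub>1\<close>, of odd arity \<open>n - 1\<close>, are matched with
  those along a fixed transversal of the external quasigroup.
\<close>

section \<open>Read-once expressions over binary quasigroups\<close>

definition latin :: "nat \<Rightarrow> (nat \<Rightarrow> nat \<Rightarrow> nat) \<Rightarrow> bool" where
  "latin q b \<longleftrightarrow>
     (\<forall>a<q. bij_betw (b a) {..<q} {..<q}) \<and> (\<forall>c<q. bij_betw (\<lambda>a. b a c) {..<q} {..<q})"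

datatype expr = Var nat | Node "nat \<Rightarrow> nat \<Rightarrow> nat" expr expr

primrec vars :: "expr \<Rightarrow> nat set" where
  "vars (Var v) = {v}"
| "vars (Node b E F) = vars E \<union> vars F"

primrec eval :: "expr \<Rightarrow> (nat \<Rightarrow> nat) \<Rightarrow> nat" where
  "eval (Var v) x = x v"
| "eval (Node b E F) x = b (eval E x) (eval F x)"

text \<open>The disjointness condition is what makes an expression read-once. It allows permutations
  for the variables of the two children to be chosen independently.\<close>

primrec wf_expr :: "nat \<Rightarrow> expr \<Rightarrow> bool" where
  "wf_expr q (Var v) \<longleftrightarrow> True"
| "wf_expr q (Node b E F) \<longleftrightarrow>
     latin q b \<and> wf_expr q E \<and> wf_expr q F \<and> vars E \<inter> vars F = {}"

primrec subst :: "(nat \<Rightarrow> expr) \<Rightarrow> expr \<Rightarrow> expr" where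
  "subst s (Var v) = s v"
| "subst s (Node b E F) = Node b (subst s E) (subst s F)"

section \<open>Latin squares, variables and substitution\<close>

lemma latin_right_cancel:
  "latin q b \<Longrightarrow> a < q \<Longrightarrow> c < q \<Longrightarrow> d < q \<Longrightarrow> b c a = b d a \<Longrightarrow> c = d"
  unfolding latin_def bij_betw_def inj_on_def by auto

lemma latin_solve_right:
  assumes "latin q b" "a < q" "d < q"
  obtains c where "c < q" "b a c = d"
proof -
  have "d \<in> b a ` {..<q}"
    using assms by (simp add: latin_def bij_betw_def)
  then show thesis using that by blast
qed

lemma latin_swap: "latin q b \<Longrightarrow> latin q (\<lambda>x y. b y x)"
  by (auto simp: latin_def)

lemma finite_vars [simp]: "finite (vars E)"
  by (induction E) auto

lemma vars_nonempty [simp]: "vars E \<noteq> {}"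
  by (induction E) auto

lemma eval_cong: "(\<And>v. v \<in> vars E \<Longrightarrow> x v = y v) \<Longrightarrow> eval E x = eval E y"
  by (induction E) auto

lemma vars_subst: "vars (subst s E) = (\<Union>v\<in>vars E. vars (s v))"
  by (induction E) auto

lemma eval_subst: "eval (subst s E) x = eval E (\<lambda>v. eval (s v) x)"
  by (induction E) auto

text \<open>Leaves in different children of a read-once expression carry different variables, so
  replacing variables by expressions with pairwise disjoint variables keeps the children
  disjoint.\<close>

lemma wf_expr_subst:
  assumes "wf_expr q E" "\<And>v. v \<in> vars E \<Longrightarrow> wf_expr q (s v)"
    and "\<And>v w. v \<in> vars E \<Longrightarrow> w \<in> vars E \<Longrightarrow> v \<noteq> w \<Longrightarrow> vars (s v) \<inter> vars (s w) = {}"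
  shows "wf_expr q (subst s E)"
  using assms
proof (induction E)
  case (Node b E F)
  have "vars (s v) \<inter> vars (s w) = {}" if "v \<in> vars E" "w \<in> vars F" for v w
    using Node.prems(1) Node.prems(3)[of v w] that by auto
  then have "vars (subst s E) \<inter> vars (subst s F) = {}"
    unfolding vars_subst by blast
  then show ?case using Node by simp
qed simp

text \<open>The hypotheses are symmetric in the three coordinates: any two determine the third.
  Hence each coordinate of a binary quasigroup can serve as the output of a Latin square, which is
  how the root gets chosen in the base case.\<close>

lemma latin_of_relation:
  assumes "\<And>a c. a < q \<Longrightarrow> c < q \<Longrightarrow> \<exists>!y. y < q \<and> R a c y"
    and "\<And>a y. a < q \<Longrightarrow> y < q \<Longrightarrow> \<exists>!c. c < q \<and> R a c y"
    and "\<And>c y. c < q \<Longrightarrow> y < q \<Longrightarrow> \<exists>!a. a < q \<and> R a c y"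
  obtains b where "latin q b" "\<And>a c y. a < q \<Longrightarrow> c < q \<Longrightarrow> y < q \<Longrightarrow> R a c y \<longleftrightarrow> y = b a c"
proof -
  define b where "b a c = (THE y. y < q \<and> R a c y)" for a c
  have b: "b a c < q \<and> R a c (b a c)" if "a < q" "c < q" for a c
    unfolding b_def using theI'[OF assms(1)[OF that]] .
  have iff: "R a c y \<longleftrightarrow> y = b a c" if "a < q" "c < q" "y < q" for a c y
    using b[OF that(1,2)] assms(1)[OF that(1,2)] that(3) by blast
  have "bij_betw (b a) {..<q} {..<q}" if "a < q" for a
  proof -
    have "inj_on (b a) {..<q}"
    proof (rule inj_onI)
      fix c d assume "c \<in> {..<q}" "d \<in> {..<q}" "b a c = b a d"
      then show "c = d"
        using b[OF that, of c] b[OF that, of d] assms(2)[OF that, of "b a c"] by auto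
    qed
    moreover have "b a ` {..<q} \<subseteq> {..<q}" using b[OF that] by auto
    ultimately show ?thesis
      by (simp add: bij_betw_def endo_inj_surj)
  qed
  moreover have "bij_betw (\<lambda>a. b a c) {..<q} {..<q}" if "c < q" for c
  proof -
    have "inj_on (\<lambda>a. b a c) {..<q}"
    proof (rule inj_onI)
      fix a d assume "a \<in> {..<q}" "d \<in> {..<q}" "b a c = b d c"
      then show "a = d"
        using b[OF _ that, of a] b[OF _ that, of d] assms(3)[OF that, of "b a c"] by auto
    qed
    moreover have "(\<lambda>a. b a c) ` {..<q} \<subseteq> {..<q}" using b[OF _ that] by auto
    ultimately show ?thesis
      by (simp add: bij_betw_def endo_inj_surj)
  qed
  ultimately have "latin q b" by (simp add: latin_def)
  then show thesis using that iff by blast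
qed

section \<open>Rooting a completely reducible quasigroup at an arbitrary variable\<close>

text \<open>The defining relation of \<open>f\<close> solved for coordinate \<open>z\<close>: the
  root \<open>0\<close> is the value of \<open>f\<close>, the root \<open>Suc i\<close> is its
  argument at list position \<open>i\<close>.\<close>

definition rooted :: "nat \<Rightarrow> nat \<Rightarrow> (nat list \<Rightarrow> nat) \<Rightarrow> nat \<Rightarrow> expr \<Rightarrow> bool" where
  "rooted q n f z E \<longleftrightarrow>
     wf_expr q E \<and> vars E = {0..n} - {z} \<and>
     (\<forall>x\<in>vecs q (n + 1). f (tl x) = x ! 0 \<longleftrightarrow> x ! z = eval E ((!) x))"

lemma vecs_nth_less: "x \<in> vecs q n \<Longrightarrow> i < n \<Longrightarrow> x ! i < q"
  by (auto simp: vecs_def subset_iff)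

lemma vecs_map: "(\<And>i. i \<in> set l \<Longrightarrow> x i < q) \<Longrightarrow> length l = n \<Longrightarrow> map x l \<in> vecs q n"
  by (auto simp: vecs_def)

lemma rooted_binary:
  assumes "quasigroup q 2 f" "z \<le> 2"
  shows "\<exists>E. rooted q 2 f z E"
proof -
  have *: "\<exists>!d. d < q \<and> f (tl ([y, a, c][k := d])) = ([y, a, c][k := d]) ! 0"
    if "y < q" "a < q" "c < q" "k \<le> 2" for y a c k
  proof -
    have "[y, a, c] \<in> vecs q (2 + 1)" using that by (simp add: vecs_def)
    then show ?thesis using assms(1) that(4) unfolding quasigroup_def by (metis (no_types, lifting))
  qed
  \<comment> \<open>In these three instances the entry that gets overwritten is filled with the
    placeholder \<open>0\<close>, which lies below \<open>q\<close> because another element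
    does.\<close>
  have Q0: "\<exists>!y. y < q \<and> f [a, c] = y" if "a < q" "c < q" for a c
    using *[of 0 a c 0] that by simp
  have Q1: "\<exists>!a. a < q \<and> f [a, c] = y" if "y < q" "c < q" for y c
    using *[of y 0 c 1] that by simp
  have Q2: "\<exists>!c. c < q \<and> f [a, c] = y" if "y < q" "a < q" for y a
    using *[of y a 0 2] that by (simp add: numeral_2_eq_2)
  have vec: "(\<forall>x\<in>vecs q (2 + 1). B x) \<longleftrightarrow> (\<forall>y<q. \<forall>a<q. \<forall>c<q. B [y, a, c])" for B
    by (auto simp: vecs_def length_Suc_conv numeral_2_eq_2)
  consider "z = 0" | "z = 1" | "z = 2" using assms(2) by linarith
  then show ?thesis
  proof cases
    case 1
    obtain b where b: "latin q b" "\<And>a c y. a < q \<Longrightarrow> c < q \<Longrightarrow> y < q \<Longrightarrow> f [a, c] = y \<longleftrightarrow> y = b a c"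
      by (rule latin_of_relation[of q "\<lambda>a c y. f [a, c] = y"]) (use Q0 Q1 Q2 in auto)
    have "rooted q 2 f z (Node b (Var 1) (Var 2))"
      unfolding rooted_def vec using b 1 by auto
    then show ?thesis ..
  next
    case 2
    obtain b where b: "latin q b" "\<And>a c y. a < q \<Longrightarrow> c < q \<Longrightarrow> y < q \<Longrightarrow> f [y, c] = a \<longleftrightarrow> y = b a c"
      by (rule latin_of_relation[of q "\<lambda>a c y. f [y, c] = a"]) (use Q0 Q1 Q2 in auto)
    have "rooted q 2 f z (Node b (Var 0) (Var 2))"
      unfolding rooted_def vec using b 2 by auto
    then show ?thesis ..
  next
    case 3
    obtain b where b: "latin q b" "\<And>a c y. a < q \<Longrightarrow> c < q \<Longrightarrow> y < q \<Longrightarrow> f [c, y] = a \<longleftrightarrow> y = b a c"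
      by (rule latin_of_relation[of q "\<lambda>a c y. f [c, y] = a"]) (use Q0 Q1 Q2 in auto)
    have "rooted q 2 f z (Node b (Var 0) (Var 1))"
      unfolding rooted_def vec using b 3 by auto
    then show ?thesis ..
  qed
qed

text \<open>The expression for \<open>h\<close>, rooted at its value, replaces the value variable in the expression
  for \<open>g\<close>, which is rooted at the argument to be solved for.\<close>

lemma rooted_compose:
  assumes g: "rooted q a g (Suc i) E" and h: "rooted q b h 0 F"
    and hq: "\<And>y. y \<in> vecs q b \<Longrightarrow> h y < q"
    and len: "length \<alpha> = a" "length \<beta> = b" "i < a"
    and dist: "distinct \<alpha>" "distinct \<beta>" "set \<alpha> \<inter> set \<beta> = {}"
  obtains G where "wf_expr q G" "vars G = (set \<alpha> \<union> set \<beta>) - {\<alpha> ! i}"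
    "\<And>x. (\<And>v. v \<in> set \<alpha> \<union> set \<beta> \<Longrightarrow> x v < q) \<Longrightarrow>
       g (map x \<alpha>) = h (map x \<beta>) \<longleftrightarrow> x (\<alpha> ! i) = eval G x"
proof
  \<comment> \<open>Variable \<open>0\<close> stands for the value of a quasigroup and variable
    \<open>j > 0\<close> for its argument at list position \<open>j - 1\<close>; hence the shift
    when arguments are renamed to the entries of \<alpha> and \<beta>. Being rooted at
    \<open>0\<close>, \<open>F\<close> contains no variable \<open>0\<close>, while in
    \<open>E\<close> this variable is the place where \<open>F'\<close> is plugged in.\<close>
  define F' where "F' = subst (\<lambda>j. Var (\<beta> ! (j - 1))) F"
  define s where "s j = (if j = 0 then F' else Var (\<alpha> ! (j - 1)))" for j
  have vE: "vars E = {0..a} - {Suc i}" and vF: "vars F = {1..b}"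
    using g h by (auto simp: rooted_def)
  have vF': "vars F' = set \<beta>"
  proof -
    have "vars F = Suc ` {0..<b}"
      unfolding vF image_Suc_atLeastLessThan by auto
    then have "vars F' = (\<lambda>j. \<beta> ! j) ` {0..<b}"
      unfolding F'_def vars_subst by (simp add: UNION_singleton_eq_range image_image del: image_Suc_atLeastLessThan)
    also have "\<dots> = set \<beta>" by (auto simp: set_conv_nth len)
    finally show ?thesis .
  qed
  have wF': "wf_expr q F'"
    unfolding F'_def
  proof (rule wf_expr_subst)
    show "wf_expr q F" using h by (simp add: rooted_def)
  next
    fix v w assume "v \<in> vars F" "w \<in> vars F" "v \<noteq> w"
    then have "v - 1 < length \<beta>" "w - 1 < length \<beta>" "v - 1 \<noteq> w - 1"
      by (auto simp: vF len)
    then show "vars (Var (\<beta> ! (v - 1))) \<inter> vars (Var (\<beta> ! (w - 1))) = {}"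
      using dist by (simp add: nth_eq_iff_index_eq)
  qed simp
  show "wf_expr q (subst s E)"
  proof (rule wf_expr_subst)
    show "wf_expr q E" using g by (simp add: rooted_def)
  next
    fix v show "wf_expr q (s v)" using wF' by (simp add: s_def)
  next
    fix v w assume vw: "v \<in> vars E" "w \<in> vars E" "v \<noteq> w"
    have *: "\<alpha> ! (j - 1) \<in> set \<alpha>" if "j \<in> vars E" "j \<noteq> 0" for j
      using that by (auto simp: vE len)
    have **: "\<alpha> ! (v - 1) \<noteq> \<alpha> ! (w - 1)" if "v \<noteq> 0" "w \<noteq> 0"
    proof -
      have "v - 1 < length \<alpha>" "w - 1 < length \<alpha>" "v - 1 \<noteq> w - 1"
        using vw that by (auto simp: vE len)
      then show ?thesis using dist by (simp add: nth_eq_iff_index_eq)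
    qed
    show "vars (s v) \<inter> vars (s w) = {}"
      using *[OF vw(1)] *[OF vw(2)] ** dist(3) vw(3) by (auto simp: s_def vF')
  qed
  have "vars (subst s E) = set \<beta> \<union> (\<lambda>j. \<alpha> ! j) ` ({0..<a} - {i})"
  proof -
    have "vars E = insert 0 (Suc ` ({0..<a} - {i}))"
    proof (rule set_eqI)
      fix v show "v \<in> vars E \<longleftrightarrow> v \<in> insert 0 (Suc ` ({0..<a} - {i}))"
        by (cases v) (auto simp: vE)
    qed
    then show ?thesis by (auto simp: vars_subst s_def vF')
  qed
  also have "(\<lambda>j. \<alpha> ! j) ` ({0..<a} - {i}) = set \<alpha> - {\<alpha> ! i}"
    using dist(1) len by (auto simp: set_conv_nth nth_eq_iff_index_eq)
  finally show "vars (subst s E) = (set \<alpha> \<union> set \<beta>) - {\<alpha> ! i}"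
    using dist(3) len by (auto simp: disjoint_iff)
  fix x assume x: "\<And>v. v \<in> set \<alpha> \<union> set \<beta> \<Longrightarrow> x v < q"
  \<comment> \<open>Fixing the value \<open>c\<close> of \<open>h\<close> turns the equation into
    \<open>g (map x \<alpha>) = c\<close>. Both rooted forms then apply, to the argument lists with
    \<open>c\<close> put in front.\<close>
  define c where "c = h (map x \<beta>)"
  have xb: "map x \<beta> \<in> vecs q b" using x len by (auto intro!: vecs_map)
  then have cq: "c < q" using hq by (simp add: c_def)
  have "c # map x \<beta> \<in> vecs q (b + 1)" using xb cq by (auto simp: vecs_def)
  then have "c = eval F ((!) (c # map x \<beta>))"
    using h by (auto simp: rooted_def c_def)
  also have "\<dots> = eval F' x"
    unfolding F'_def eval_subst by (rule eval_cong) (auto simp: vF len nth_Cons')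
  finally have c: "c = eval F' x" .
  have "c # map x \<alpha> \<in> vecs q (a + 1)" using x cq len by (auto simp: vecs_def)
  then have "g (map x \<alpha>) = c \<longleftrightarrow> x (\<alpha> ! i) = eval E ((!) (c # map x \<alpha>))"
    using g len by (auto simp: rooted_def)
  also have "eval E ((!) (c # map x \<alpha>)) = eval (subst s E) x"
    unfolding eval_subst by (rule eval_cong) (auto simp: vE len nth_Cons' s_def c)
  finally show "g (map x \<alpha>) = h (map x \<beta>) \<longleftrightarrow> x (\<alpha> ! i) = eval (subst s E) x"
    by (simp add: c_def)
qed

text \<open>The root \<open>z\<close> is an argument of exactly one of \<open>g\<close> and
  \<open>h\<close>. That one is rooted at the argument in question, the other at its value, and the
  two expressions are joined by substitution. Since different roots are needed for the parts, the
  induction is over all \<open>z\<close> at once.\<close>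

lemma completely_reducible_rooted:
  "completely_reducible q n f \<Longrightarrow> z \<le> n \<Longrightarrow> \<exists>E. rooted q n f z E"
proof (induction arbitrary: z rule: completely_reducible.induct)
  case (binary f)
  then show ?case by (rule rooted_binary)
next
  case (compose n f m h g)
  have comp: "composition q n m f h g" by (rule compose.hyps)
  then have mn: "m \<le> n"
    and gq: "\<And>y. y \<in> vecs q (m + 1) \<Longrightarrow> g y < q" and hq: "\<And>y. y \<in> vecs q (n - m) \<Longrightarrow> h y < q"
    unfolding composition_def quasigroup_def by simp_all
  from comp obtain \<sigma> where \<sigma>: "\<sigma> permutes {0..n}"
    and f: "\<And>x. x \<in> vecs q (n + 1) \<Longrightarrow> f (tl x) = x ! 0 \<longleftrightarrow>
           g (map (\<lambda>i. x ! \<sigma> i) [0..<m + 1]) = h (map (\<lambda>i. x ! \<sigma> i) [m + 1..<n + 1])"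
    unfolding composition_def by blast
  define \<alpha> where "\<alpha> = map \<sigma> [0..<m + 1]"
  define \<beta> where "\<beta> = map \<sigma> [m + 1..<n + 1]"
  have inj: "inj \<sigma>" using \<sigma> by (rule permutes_inj)
  have len: "length \<alpha> = m + 1" "length \<beta> = n - m" by (auto simp: \<alpha>_def \<beta>_def)
  have dist: "distinct \<alpha>" "distinct \<beta>" "set \<alpha> \<inter> set \<beta> = {}"
    using inj_eq[OF inj] inj_on_subset[OF inj subset_UNIV]
    by (auto simp: \<alpha>_def \<beta>_def distinct_map simp del: upt_Suc)
  have "set \<alpha> \<union> set \<beta> = \<sigma> ` {0..n}"
    unfolding \<alpha>_def \<beta>_def set_map image_Un[symmetric]
    by (rule arg_cong[where f = "image \<sigma>"]) (use mn in auto)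
  then have un: "set \<alpha> \<union> set \<beta> = {0..n}" using permutes_image[OF \<sigma>] by simp
  have f': "f (tl x) = x ! 0 \<longleftrightarrow> g (map ((!) x) \<alpha>) = h (map ((!) x) \<beta>)"
    if "x \<in> vecs q (n + 1)" for x
    using f[OF that] by (simp add: \<alpha>_def \<beta>_def comp_def del: upt_Suc)
  have less: "x ! v < q" if "x \<in> vecs q (n + 1)" "v \<in> {0..n}" for x v
    using that by (auto intro: vecs_nth_less)
  obtain Eg where Eg: "rooted q (m + 1) g 0 Eg" using compose.IH(2) by blast
  obtain Eh where Eh: "rooted q (n - m) h 0 Eh" using compose.IH(1) by blast
  have "z \<in> set \<alpha> \<union> set \<beta>" unfolding un using compose.prems by simp
  then consider "z \<in> set \<alpha>" | "z \<in> set \<beta>" by blast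
  then show ?case
  proof cases
    case 1
    then obtain i where i: "i < m + 1" "z = \<alpha> ! i" using len by (auto simp: in_set_conv_nth)
    obtain E where E: "rooted q (m + 1) g (Suc i) E"
      using compose.IH(2)[of "Suc i"] i by auto
    obtain G where G: "wf_expr q G" "vars G = (set \<alpha> \<union> set \<beta>) - {\<alpha> ! i}"
      "\<And>x. (\<And>v. v \<in> set \<alpha> \<union> set \<beta> \<Longrightarrow> x v < q) \<Longrightarrow>
         g (map x \<alpha>) = h (map x \<beta>) \<longleftrightarrow> x (\<alpha> ! i) = eval G x"
      using rooted_compose[OF E Eh hq len i(1) dist] by blast
    have "rooted q n f z G"
      unfolding rooted_def
    proof (intro conjI ballI)
      show "vars G = {0..n} - {z}" using G(2) un i by auto
      fix x assume x: "x \<in> vecs q (n + 1)"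
      show "f (tl x) = x ! 0 \<longleftrightarrow> x ! z = eval G ((!) x)"
        using G(3)[of "(!) x"] less[OF x] f'[OF x] un i by simp
    qed (rule G(1))
    then show ?thesis ..
  next
    case 2
    then obtain i where i: "i < n - m" "z = \<beta> ! i" using len by (auto simp: in_set_conv_nth)
    obtain E where E: "rooted q (n - m) h (Suc i) E"
      using compose.IH(1)[of "Suc i"] i by auto
    \<comment> \<open>The equation \<open>g = h\<close> is symmetric, so the same joining works with
      the two quasigroups exchanged.\<close>
    have dist': "set \<beta> \<inter> set \<alpha> = {}" using dist(3) by blast
    obtain G where G: "wf_expr q G" "vars G = (set \<beta> \<union> set \<alpha>) - {\<beta> ! i}"
      "\<And>x. (\<And>v. v \<in> set \<beta> \<union> set \<alpha> \<Longrightarrow> x v < q) \<Longrightarrow>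
         h (map x \<beta>) = g (map x \<alpha>) \<longleftrightarrow> x (\<beta> ! i) = eval G x"
      using rooted_compose[OF E Eg gq len(2,1) i(1) dist(2,1) dist'] by blast
    have "rooted q n f z G"
      unfolding rooted_def
    proof (intro conjI ballI)
      show "vars G = {0..n} - {z}" using G(2) un i by auto
      fix x assume x: "x \<in> vecs q (n + 1)"
      show "f (tl x) = x ! 0 \<longleftrightarrow> x ! z = eval G ((!) x)"
        using G(3)[of "(!) x"] less[OF x] f'[OF x] un i by (simp add: eq_commute Un_commute)
    qed (rule G(1))
    then show ?thesis ..
  qed
qed

section \<open>Counting families of permutations with prescribed values\<close>

text \<open>\<open>X v i\<close> is the value of the variable \<open>v\<close> in the \<open>i\<close>-th of the \<open>q\<close> tuples.\<close>

definition families :: "nat \<Rightarrow> expr \<Rightarrow> (nat \<Rightarrow> nat) \<Rightarrow> (nat \<Rightarrow> nat \<Rightarrow> nat) set" where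
  "families q E p =
     {X \<in> PiE (vars E) (\<lambda>_. {r. r permutes {..<q}}). \<forall>i<q. eval E (\<lambda>v. X v i) = p i}"

lemma finite_families [simp]: "finite (families q E p)"
proof -
  have "finite (PiE (vars E) (\<lambda>_. {r. r permutes {..<q}}))"
    by (intro finite_PiE finite_permutations) auto
  then show ?thesis by (rule rev_finite_subset) (auto simp: families_def)
qed

lemma families_permutes: "X \<in> families q E p \<Longrightarrow> v \<in> vars E \<Longrightarrow> X v permutes {..<q}"
  by (auto simp: families_def PiE_iff)

text \<open>Members of \<open>families\<close> are \<open>undefined\<close> off
  \<open>vars E\<close>, and their permutations fix every number from \<open>q\<close> on. So the
  entries with \<open>i < q\<close> determine a family, and counting these functions counts the
  actual choices.\<close>

lemma families_ext:
  assumes X: "X \<in> families q E p" and Y: "Y \<in> families q E p'"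
    and eq: "\<And>v i. v \<in> vars E \<Longrightarrow> i < q \<Longrightarrow> X v i = Y v i"
  shows "X = Y"
proof (rule PiE_ext)
  show "X \<in> PiE (vars E) (\<lambda>_. {r. r permutes {..<q}})" "Y \<in> PiE (vars E) (\<lambda>_. {r. r permutes {..<q}})"
    using X Y by (auto simp: families_def)
  fix v assume v: "v \<in> vars E"
  show "X v = Y v"
  proof
    fix i show "X v i = Y v i"
      using eq[OF v] permutes_not_in[OF families_permutes[OF X v], of i]
        permutes_not_in[OF families_permutes[OF Y v], of i]
      by (cases "i < q") auto
  qed
qed

text \<open>An index \<open>k\<close> prescribes value sequences \<open>P k\<close> and
  \<open>R k\<close> for the children that \<open>b\<close> combines to \<open>p\<close>. Families
  for the children glue along the disjoint variable sets, and \<open>k\<close> can be recovered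
  because evaluating \<open>E\<close> returns \<open>P k\<close>. The index set is kept abstract so
  that it can be either the constants or the permutations.\<close>

lemma families_Node:
  fixes K :: "'k set"
  assumes disj: "vars E \<inter> vars F = {}" and "finite K"
    and comb: "\<And>k i. k \<in> K \<Longrightarrow> i < q \<Longrightarrow> b (P k i) (R k i) = p i"
    and sep: "\<And>k l. k \<in> K \<Longrightarrow> l \<in> K \<Longrightarrow> (\<And>i. i < q \<Longrightarrow> P k i = P l i) \<Longrightarrow> k = l"
    and M: "\<And>k. k \<in> K \<Longrightarrow> M \<le> card (families q E (P k))"
    and N: "\<And>k. k \<in> K \<Longrightarrow> N \<le> card (families q F (R k))"
  shows "card K * (M * N) \<le> card (families q (Node b E F) p)"
proof -
  let ?S = "SIGMA k:K. families q E (P k) \<times> families q F (R k)"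
  define glue :: "'k \<times> (nat \<Rightarrow> nat \<Rightarrow> nat) \<times> (nat \<Rightarrow> nat \<Rightarrow> nat) \<Rightarrow> nat \<Rightarrow> nat \<Rightarrow> nat" where
    "glue = (\<lambda>(k, X, Y) v. if v \<in> vars E then X v else if v \<in> vars F then Y v else undefined)"
  have glue_E: "glue (k, X, Y) v = X v" if "v \<in> vars E" for k X Y v
    using that by (simp add: glue_def)
  have glue_F: "glue (k, X, Y) v = Y v" if "v \<in> vars F" for k X Y v
    using that disj by (auto simp: glue_def)
  have inj: "inj_on glue ?S"
  proof (rule inj_onI)
    fix s t assume st: "s \<in> ?S" "t \<in> ?S" "glue s = glue t"
    obtain k X Y where s: "s = (k, X, Y)" by (cases s)
    obtain l X' Y' where t: "t = (l, X', Y')" by (cases t)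
    from st have kl: "k \<in> K" "l \<in> K" and X: "X \<in> families q E (P k)" "X' \<in> families q E (P l)"
      and Y: "Y \<in> families q F (R k)" "Y' \<in> families q F (R l)"
      and eq: "glue (k, X, Y) = glue (l, X', Y')"
      by (auto simp: s t)
    have XX: "X = X'"
      by (rule families_ext[OF X(1) X(2)]) (metis glue_E eq)
    have YY: "Y = Y'"
      by (rule families_ext[OF Y(1) Y(2)]) (metis glue_F eq)
    have "P k i = P l i" if "i < q" for i
      using X XX that by (auto simp: families_def)
    then have "k = l" using sep kl by blast
    then show "s = t" using XX YY by (simp add: s t)
  qed
  have img: "glue ` ?S \<subseteq> families q (Node b E F) p"
  proof clarify
    fix k X Y assume k: "k \<in> K" and X: "X \<in> families q E (P k)" and Y: "Y \<in> families q F (R k)"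
    have "eval E (\<lambda>v. glue (k, X, Y) v i) = eval E (\<lambda>v. X v i)" for i
      by (rule eval_cong) (simp add: glue_E)
    moreover have "eval F (\<lambda>v. glue (k, X, Y) v i) = eval F (\<lambda>v. Y v i)" for i
      by (rule eval_cong) (simp add: glue_F)
    moreover have "glue (k, X, Y) \<in> PiE (vars E \<union> vars F) (\<lambda>_. {r. r permutes {..<q}})"
      using X Y by (auto simp: families_def glue_def PiE_iff extensional_def)
    ultimately show "glue (k, X, Y) \<in> families q (Node b E F) p"
      using X Y comb[OF k] by (simp add: families_def)
  qed
  have "card K * (M * N) = (\<Sum>k\<in>K. M * N)" by simp
  also have "\<dots> \<le> (\<Sum>k\<in>K. card (families q E (P k) \<times> families q F (R k)))"
    unfolding card_cartesian_product by (intro sum_mono mult_le_mono M N)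
  also have "\<dots> = card ?S"
    using \<open>finite K\<close> by (intro card_SigmaI[symmetric]) auto
  also have "\<dots> = card (glue ` ?S)" using inj by (simp add: card_image)
  also have "\<dots> \<le> card (families q (Node b E F) p)"
    using img by (intro card_mono) auto
  finally show ?thesis .
qed

text \<open>Transposing the operation reduces a node with odd left and even right child to the
  opposite arrangement.\<close>

lemma families_swap: "families q (Node b E F) p = families q (Node (\<lambda>x y. b y x) F E) p"
  by (simp add: families_def Un_commute)

text \<open>Solving for each \<open>i\<close> separately gives \<open>r\<close>. It is injective by
  cancellation: \<open>r i = r j\<close> forces \<open>p i = p j\<close>.\<close>

lemma latin_solve_permutation:
  assumes b: "latin q b" and p: "bij_betw p {..<q} {..<q}" and c: "c < q"
  obtains r where "bij_betw r {..<q} {..<q}" "\<And>i. i < q \<Longrightarrow> b (p i) (r i) = c"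
proof -
  have pq: "p i < q" if "i < q" for i using p that by (auto simp: bij_betw_def)
  have "\<exists>d. \<forall>i\<in>{..<q}. d i < q \<and> b (p i) (d i) = c"
    by (rule bchoice) (use latin_solve_right[OF b pq c] in blast)
  then obtain r where r: "\<And>i. i < q \<Longrightarrow> r i < q" "\<And>i. i < q \<Longrightarrow> b (p i) (r i) = c" by auto
  have "inj_on r {..<q}"
  proof (rule inj_onI)
    fix i j assume ij: "i \<in> {..<q}" "j \<in> {..<q}" "r i = r j"
    then have "p i = p j"
      using r[of i] r[of j] pq[of i] pq[of j] latin_right_cancel[OF b, of "r i" "p i" "p j"] by auto
    then show "i = j" using p ij by (auto simp: bij_betw_def inj_on_def)
  qed
  moreover have "r ` {..<q} \<subseteq> {..<q}" using r by auto
  ultimately have "bij_betw r {..<q} {..<q}" by (simp add: bij_betw_def endo_inj_surj)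
  then show thesis using that r by blast
qed

text \<open>Row \<open>c\<close> of a Latin square is a permutation; its inverse applied after
  \<open>p\<close> is the solution.\<close>

lemma latin_solve_translate:
  assumes b: "latin q b" and p: "bij_betw p {..<q} {..<q}" and c: "c < q"
  obtains r where "bij_betw r {..<q} {..<q}" "\<And>i. i < q \<Longrightarrow> b c (r i) = p i"
proof -
  have bc: "bij_betw (b c) {..<q} {..<q}" using b c by (simp add: latin_def)
  define r where "r = inv_into {..<q} (b c) \<circ> p"
  have "bij_betw r {..<q} {..<q}"
    unfolding r_def by (rule bij_betw_trans[OF p bij_betw_inv_into[OF bc]])
  moreover have "b c (r i) = p i" if "i < q" for i
  proof -
    have "p i \<in> {..<q}" using p that by (auto simp: bij_betw_def)
    then show ?thesis using bij_betw_inv_into_right[OF bc] by (simp add: r_def)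
  qed
  ultimately show thesis by (rule that)
qed

section \<open>Counting at a node by the parities of its children\<close>

lemma families_Node_even_odd:
  assumes b: "latin q b" and disj: "vars E \<inter> vars F = {}" and p: "bij_betw p {..<q} {..<q}"
    and M: "\<And>c. c < q \<Longrightarrow> M \<le> card (families q E (\<lambda>_. c))"
    and N: "\<And>r. bij_betw r {..<q} {..<q} \<Longrightarrow> N \<le> card (families q F r)"
  shows "q * (M * N) \<le> card (families q (Node b E F) p)"
proof -
  have "\<exists>r. bij_betw r {..<q} {..<q} \<and> (\<forall>i<q. b c (r i) = p i)" if "c < q" for c
    using latin_solve_translate[OF b p that] by metis
  then obtain r where r: "\<And>c. c < q \<Longrightarrow> bij_betw (r c) {..<q} {..<q}"
    "\<And>c i. c < q \<Longrightarrow> i < q \<Longrightarrow> b c (r c i) = p i" by metis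
  have "card {..<q} * (M * N) \<le> card (families q (Node b E F) p)"
    by (rule families_Node[where P = "\<lambda>c _. c" and R = r])
      (use disj r M N in auto)
  then show ?thesis by simp
qed

lemma families_Node_even_even:
  assumes b: "latin q b" and disj: "vars E \<inter> vars F = {}" and d: "d < q"
    and M: "\<And>c. c < q \<Longrightarrow> M \<le> card (families q E (\<lambda>_. c))"
    and N: "\<And>c. c < q \<Longrightarrow> N \<le> card (families q F (\<lambda>_. c))"
  shows "q * (M * N) \<le> card (families q (Node b E F) (\<lambda>_. d))"
proof -
  have "\<exists>e. e < q \<and> b c e = d" if "c < q" for c
    using latin_solve_right[OF b that d] by metis
  then obtain e where e: "\<And>c. c < q \<Longrightarrow> e c < q" "\<And>c. c < q \<Longrightarrow> b c (e c) = d" by metis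
  have "card {..<q} * (M * N) \<le> card (families q (Node b E F) (\<lambda>_. d))"
    by (rule families_Node[where P = "\<lambda>c _. c" and R = "\<lambda>c _. e c"])
      (use disj e M N d in auto)
  then show ?thesis by simp
qed

text \<open>Every permutation prescribed for \<open>E\<close> has a matching permutation for
  \<open>F\<close> by \<open>latin_solve_permutation\<close>; the factor \<open>fact q\<close>
  counts the permutations available for \<open>E\<close>.\<close>

lemma families_Node_odd_odd:
  assumes b: "latin q b" and disj: "vars E \<inter> vars F = {}" and d: "d < q"
    and M: "\<And>r. bij_betw r {..<q} {..<q} \<Longrightarrow> M \<le> card (families q E r)"
    and N: "\<And>r. bij_betw r {..<q} {..<q} \<Longrightarrow> N \<le> card (families q F r)"
  shows "fact q * (M * N) \<le> card (families q (Node b E F) (\<lambda>_. d))"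
proof -
  let ?K = "{p. p permutes {..<q}}"
  have bij: "bij_betw p {..<q} {..<q}" if "p \<in> ?K" for p
    using that permutes_imp_bij by blast
  have "\<exists>r. bij_betw r {..<q} {..<q} \<and> (\<forall>i<q. b (p i) (r i) = d)" if "p \<in> ?K" for p
    using latin_solve_permutation[OF b bij[OF that] d] by metis
  then obtain r where r: "\<And>p. p \<in> ?K \<Longrightarrow> bij_betw (r p) {..<q} {..<q}"
    "\<And>p i. p \<in> ?K \<Longrightarrow> i < q \<Longrightarrow> b (p i) (r p i) = d" by metis
  have "card ?K * (M * N) \<le> card (families q (Node b E F) (\<lambda>_. d))"
  proof (rule families_Node[where P = "\<lambda>p. p" and R = r])
    fix k l assume kl: "k \<in> ?K" "l \<in> ?K" "\<And>i. i < q \<Longrightarrow> k i = l i"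
    show "k = l"
    proof
      fix i show "k i = l i"
        using kl permutes_not_in[of k "{..<q}" i] permutes_not_in[of l "{..<q}" i]
        by (cases "i < q") auto
    qed
  qed (use disj r M N bij in \<open>auto simp: finite_permutations\<close>)
  then show ?thesis by (simp add: card_permutations)
qed

text \<open>The two parities must be treated together: an odd node has one child of each parity, and
  an even node has two children of equal parity. The bounds hold for every prescribed permutation or
  constant, because a node imposes such arbitrary targets on its children.\<close>

lemma card_families:
  assumes "wf_expr q E"
  shows "(odd (card (vars E)) \<longrightarrow> (\<forall>p. bij_betw p {..<q} {..<q} \<longrightarrow>
            (q * fact q) ^ ((card (vars E) - 1) div 2) \<le> card (families q E p))) \<and>
         (even (card (vars E)) \<longrightarrow> (\<forall>c<q.
            fact q * (q * fact q) ^ ((card (vars E) - 2) div 2) \<le> card (families q E (\<lambda>_. c))))"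
  using assms
proof (induction E)
  case (Var v)
  have "1 \<le> card (families q (Var v) p)" if p: "bij_betw p {..<q} {..<q}" for p
  proof -
    \<comment> \<open>Only the values of \<open>p\<close> below \<open>q\<close> matter; extending
      by the identity yields an element of the set of permutations used in
      \<open>families\<close>.\<close>
    define r where "r = (\<lambda>i. if i < q then p i else i)"
    have "bij_betw r {..<q} {..<q}"
      using p by (rule bij_betw_cong[THEN iffD1, rotated]) (simp add: r_def)
    then have "r permutes {..<q}" by (rule bij_imp_permutes) (simp add: r_def)
    then have "(\<lambda>w\<in>{v}. r) \<in> families q (Var v) p"
      by (auto simp: families_def r_def)
    then have "families q (Var v) p \<noteq> {}" by blast
    then show ?thesis by (simp add: Suc_le_eq card_gt_0_iff)
  qed
  then show ?case by simp
next
  case (Node b E F)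
  let ?m = "card (vars E)" and ?n = "card (vars F)" and ?t = "q * fact q"
  from Node.prems have b: "latin q b" and disj: "vars E \<inter> vars F = {}" by auto
  have disj': "vars F \<inter> vars E = {}" using disj by blast
  have card: "card (vars (Node b E F)) = ?m + ?n" by (simp add: card_Un_disjoint disj)
  have oE: "?t ^ ((?m - 1) div 2) \<le> card (families q E p)" if "odd ?m" "bij_betw p {..<q} {..<q}" for p
    using Node that by simp
  have oF: "?t ^ ((?n - 1) div 2) \<le> card (families q F p)" if "odd ?n" "bij_betw p {..<q} {..<q}" for p
    using Node that by simp
  have eE: "fact q * ?t ^ ((?m - 2) div 2) \<le> card (families q E (\<lambda>_. c))" if "even ?m" "c < q" for c
    using Node that by simp
  have eF: "fact q * ?t ^ ((?n - 2) div 2) \<le> card (families q F (\<lambda>_. c))" if "even ?n" "c < q" for c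
    using Node that by simp
  have pos: "0 < ?m" "0 < ?n" by (auto simp: card_gt_0_iff)
  consider (oo) "odd ?m" "odd ?n" | (ee) "even ?m" "even ?n"
    | (eo) "even ?m" "odd ?n" | (oe) "odd ?m" "even ?n" by blast
  then show ?case
  proof cases
    case oo
    then obtain i j where "?m = 2 * i + 1" "?n = 2 * j + 1" by (auto elim!: oddE)
    then show ?thesis
      using families_Node_odd_odd[OF b disj _ oE[OF oo(1)] oF[OF oo(2)]] oo card
      by (simp add: power_add)
  next
    case ee
    \<comment> \<open>An even number of variables is at least 2, hence \<open>Suc\<close>. With
      \<open>t = q * fact q\<close> the product
      \<open>q * (fact q * t ^ i) * (fact q * t ^ j)\<close> equals
      \<open>fact q * t ^ (i + j + 1)\<close>, which is the required bound.\<close>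
    then obtain i j where "?m = 2 * Suc i" "?n = 2 * Suc j"
      using pos by (metis dvdE mult_0_right not0_implies_Suc less_irrefl)
    then show ?thesis
      using families_Node_even_even[OF b disj _ eE[OF ee(1)] eF[OF ee(2)]] ee card
      by (simp add: power_add mult_ac)
  next
    case eo
    \<comment> \<open>Here \<open>q * (fact q * t ^ i) * t ^ j = t ^ (i + j + 1)\<close>: the
      constant of the even child supplies the factor \<open>q\<close> that completes
      \<open>fact q\<close> to \<open>t\<close>.\<close>
    then obtain i j where "?m = 2 * Suc i" "?n = 2 * j + 1"
      using pos by (metis dvdE oddE mult_0_right not0_implies_Suc less_irrefl)
    then show ?thesis
      using families_Node_even_odd[OF b disj _ eE[OF eo(1)] oF[OF eo(2)]] eo card
      by (simp add: power_add mult_ac)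
  next
    case oe
    then obtain i j where "?m = 2 * i + 1" "?n = 2 * Suc j"
      using pos by (metis dvdE oddE mult_0_right not0_implies_Suc less_irrefl)
    then show ?thesis
      using families_Node_even_odd[OF latin_swap[OF b] disj' _ eF[OF oe(2)] oE[OF oe(1)]] oe card
      by (simp add: power_add mult_ac families_swap[of q b])
  qed
qed

section \<open>From families to transversals\<close>

lemma finite_vecs: "finite (vecs q n)"
  unfolding vecs_def using finite_lists_length_eq[of "{..<q}" n] by (simp add: conj_commute)

lemma finite_transversals: "finite {T. transversal q n f T}"
  by (rule finite_subset[of _ "Pow (vecs q (n + 1))"]) (auto simp: transversal_def finite_vecs)

text \<open>The coordinate \<open>k\<close>, on which all members of \<open>S\<close> agree, recovers the indexing of the tuples
  from the set of tuples.\<close>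

lemma card_le_transversals:
  assumes vec: "\<And>X i. X \<in> S \<Longrightarrow> i < q \<Longrightarrow> w X i \<in> vecs q (n + 1)"
    and sol: "\<And>X i. X \<in> S \<Longrightarrow> i < q \<Longrightarrow> w X i ! 0 = f (tl (w X i))"
    and inj: "\<And>X j. X \<in> S \<Longrightarrow> j \<le> n \<Longrightarrow> inj_on (\<lambda>i. w X i ! j) {..<q}"
    and key: "k \<le> n" "\<And>X i. X \<in> S \<Longrightarrow> i < q \<Longrightarrow> w X i ! k = p i"
    and sep: "\<And>X Y. X \<in> S \<Longrightarrow> Y \<in> S \<Longrightarrow> (\<And>i. i < q \<Longrightarrow> w X i = w Y i) \<Longrightarrow> X = Y"
  shows "card S \<le> card {T. transversal q n f T}"
proof (rule card_inj_on_le[where f = "\<lambda>X. w X ` {..<q}"])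
  show "inj_on (\<lambda>X. w X ` {..<q}) S"
  proof (rule inj_onI)
    fix X Y assume XY: "X \<in> S" "Y \<in> S" "w X ` {..<q} = w Y ` {..<q}"
    have "w X i = w Y i" if i: "i < q" for i
    proof -
      obtain j where j: "j < q" "w X i = w Y j" using XY(3) i by blast
      \<comment> \<open>Coordinate \<open>k\<close> depends on the index alone:
        \<open>w X i ! k = w Y j ! k = p j = w X j ! k\<close>.\<close>
      then have "w X i ! k = w X j ! k" using key(2) XY i by metis
      then have "i = j" using inj[OF XY(1) key(1)] i j by (auto simp: inj_on_def)
      then show ?thesis using j by simp
    qed
    then show "X = Y" using sep XY by blast
  qed
  show "(\<lambda>X. w X ` {..<q}) ` S \<subseteq> {T. transversal q n f T}"
  proof clarify
    fix X assume X: "X \<in> S"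
    have "inj_on (w X) {..<q}"
      using inj[OF X, of 0] by (auto simp: inj_on_def)
    then have "card (w X ` {..<q}) = q" by (simp add: card_image)
    moreover have "w X i ! j \<noteq> w X i' ! j" if "i < q" "i' < q" "w X i \<noteq> w X i'" "j \<le> n" for i i' j
      using inj[OF X that(4)] that(1-3) by (auto simp: inj_on_def)
    ultimately show "transversal q n f (w X ` {..<q})"
      unfolding transversal_def using vec[OF X] sol[OF X] by auto
  qed
qed (rule finite_transversals)

lemma families_less: "X \<in> families q E p \<Longrightarrow> v \<in> vars E \<Longrightarrow> i < q \<Longrightarrow> X v i < q"
  using permutes_in_image[OF families_permutes] by blast

lemma families_inj: "X \<in> families q E p \<Longrightarrow> v \<in> vars E \<Longrightarrow> inj_on (X v) A"
  by (metis families_permutes permutes_inj inj_on_subset subset_UNIV)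

text \<open>Prescribing the identity permutation for the root makes \<open>i\<close> the value of
  \<open>f\<close> at the \<open>i\<close>-th argument tuple. Each tuple is thus indexed by its own
  value coordinate.\<close>

lemma rooted_families:
  assumes E: "rooted q n f 0 E" and X: "X \<in> families q E (\<lambda>i. i)" and i: "i < q"
  shows "i # map (\<lambda>v. X v i) [1..<n + 1] \<in> vecs q (n + 1)"
    and "f (map (\<lambda>v. X v i) [1..<n + 1]) = i"
proof -
  let ?x = "i # map (\<lambda>v. X v i) [1..<n + 1]"
  have vE: "vars E = {1..n}" using E by (auto simp: rooted_def)
  show x: "?x \<in> vecs q (n + 1)"
    using families_less[OF X] i by (auto simp: vecs_def vE)
  have "eval E ((!) ?x) = eval E (\<lambda>v. X v i)"
    by (rule eval_cong) (auto simp: vE nth_Cons' simp del: upt_Suc)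
  also have "\<dots> = i" using X i by (simp add: families_def)
  finally have "?x ! 0 = eval E ((!) ?x)" by simp
  then have "f (tl ?x) = ?x ! 0" using E x by (auto simp: rooted_def)
  then show "f (map (\<lambda>v. X v i) [1..<n + 1]) = i" by simp
qed

lemma card_families_rooted:
  assumes "rooted q n f 0 E" "odd n"
  shows "(q * fact q) ^ ((n - 1) div 2) \<le> card (families q E (\<lambda>i. i))"
proof -
  have "vars E = {1..n}" using assms by (auto simp: rooted_def)
  then have "card (vars E) = n" by simp
  then show ?thesis
    using card_families[of q E] assms by (auto simp: rooted_def bij_betw_def)
qed

lemma transversals_odd:
  assumes "completely_reducible q n f" "odd n"
  shows "(q * fact q) ^ ((n - 1) div 2) \<le> card {T. transversal q n f T}"
proof -
  obtain E where E: "rooted q n f 0 E" using completely_reducible_rooted[OF assms(1)] by blast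
  have vE: "vars E = {1..n}" using E by (auto simp: rooted_def)
  define w where "w X i = i # map (\<lambda>v. X v i) [1..<n + 1]" for X :: "nat \<Rightarrow> nat \<Rightarrow> nat" and i
  have w0: "w X i ! 0 = i" for X i by (simp add: w_def)
  have wv: "w X i ! v = X v i" if "v \<in> {1..n}" for X i v
    using that by (auto simp: w_def nth_Cons' simp del: upt_Suc)
  have "card (families q E (\<lambda>i. i)) \<le> card {T. transversal q n f T}"
  proof (rule card_le_transversals[where w = w and k = 0 and p = "\<lambda>i. i"])
    fix X i assume X: "X \<in> families q E (\<lambda>i. i)" "i < q"
    show "w X i \<in> vecs q (n + 1)" "w X i ! 0 = f (tl (w X i))"
      using rooted_families[OF E X] by (simp_all add: w_def)
  next
    fix X j assume X: "X \<in> families q E (\<lambda>i. i)" and j: "j \<le> n"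
    show "inj_on (\<lambda>i. w X i ! j) {..<q}"
    proof (cases "j = 0")
      case False
      then have "j \<in> {1..n}" using j by simp
      then show ?thesis using families_inj[OF X, of j "{..<q}"] wv by (simp add: vE)
    qed (simp add: w0)
  next
    fix X Y assume XY: "X \<in> families q E (\<lambda>i. i)" "Y \<in> families q E (\<lambda>i. i)"
      "\<And>i. i < q \<Longrightarrow> w X i = w Y i"
    show "X = Y"
      by (rule families_ext[OF XY(1,2)]) (metis wv XY(3) vE)
  qed (simp_all add: w0)
  then show ?thesis using card_families_rooted[OF E assms(2)] by linarith
qed

section \<open>Even arity: matching with a transversal of the external quasigroup\<close>

lemma transversal_binaryE:
  assumes "transversal q 2 h T"
  obtains y z where "\<And>i. i < q \<Longrightarrow> y i < q" "\<And>i. i < q \<Longrightarrow> z i < q"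
    "\<And>i. i < q \<Longrightarrow> h [y i, z i] = i" "inj_on y {..<q}" "inj_on z {..<q}"
proof -
  have T: "T \<subseteq> vecs q (2 + 1)" "card T = q" "\<And>x. x \<in> T \<Longrightarrow> x ! 0 = h (tl x)"
    and ne: "\<And>x y k. x \<in> T \<Longrightarrow> y \<in> T \<Longrightarrow> x \<noteq> y \<Longrightarrow> k \<le> 2 \<Longrightarrow> x ! k \<noteq> y ! k"
    using assms by (auto simp: transversal_def)
  \<comment> \<open>The value coordinate is injective on the \<open>q\<close> members of
    \<open>T\<close>, so it takes every value below \<open>q\<close> exactly once and can index the
    transversal.\<close>
  have "inj_on (\<lambda>x. x ! 0) T" using ne by (auto simp: inj_on_def)
  then have "card ((\<lambda>x. x ! 0) ` T) = q" using T(2) by (simp add: card_image)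
  moreover have "(\<lambda>x. x ! 0) ` T \<subseteq> {..<q}" using T(1) vecs_nth_less[of _ q "2 + 1" 0] by auto
  ultimately have "(\<lambda>x. x ! 0) ` T = {..<q}" by (intro card_subset_eq) auto
  then have "\<forall>i\<in>{..<q}. \<exists>x. x \<in> T \<and> x ! 0 = i" by (metis imageE)
  then obtain t where t: "\<And>i. i < q \<Longrightarrow> t i \<in> T" "\<And>i. i < q \<Longrightarrow> t i ! 0 = i"
    by (metis lessThan_iff)
  have tv: "t i \<in> vecs q 3" if "i < q" for i using t(1)[OF that] T(1) by auto
  have tl: "tl (t i) = [t i ! 1, t i ! 2]" if "i < q" for i
    using tv[OF that] by (auto simp: vecs_def length_Suc_conv numeral_2_eq_2 numeral_3_eq_3)
  have inj: "inj_on (\<lambda>i. t i ! k) {..<q}" if "k \<le> 2" for k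
  proof (rule inj_onI)
    fix i j assume ij: "i \<in> {..<q}" "j \<in> {..<q}" "t i ! k = t j ! k"
    then have "t i = t j" using ne[of "t i" "t j" k] t(1) that by auto
    then show "i = j" using t(2) ij by (metis lessThan_iff)
  qed
  show thesis
  proof (rule that[of "\<lambda>i. t i ! 1" "\<lambda>i. t i ! 2"])
    fix i assume i: "i < q"
    show "t i ! 1 < q" "t i ! 2 < q" using tv[OF i] by (auto intro: vecs_nth_less)
    show "h [t i ! 1, t i ! 2] = i" using T(3)[OF t(1)[OF i]] tl[OF i] t(2)[OF i] by simp
  qed (use inj in auto)
qed

text \<open>The \<open>i\<close>-th argument tuple of \<open>h1\<close> has value \<open>i\<close>,
  and so has the pair \<open>y i\<close>, \<open>z i\<close> under \<open>h2\<close>. The pairs stay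
  fixed and only the families for \<open>h1\<close> vary, so the count is that of the odd arity
  \<open>n - 1\<close>.\<close>

lemma transversals_even:
  assumes rep: "proper_representation q n f \<pi> h1 h2" and "even n" and T: "transversal q 2 h2 T"
  shows "(q * fact q) ^ ((n - 1) div 2) \<le> card {T. transversal q n f T}"
proof -
  have h1: "completely_reducible q (n - 1) h1" and \<pi>: "\<pi> permutes {0..n}"
    and f: "\<And>x. x \<in> vecs q (n + 1) \<Longrightarrow> x ! 0 = f (tl x) \<longleftrightarrow>
        h1 (map (\<lambda>i. x ! \<pi> i) [0..<n - 1]) = h2 [x ! \<pi> (n - 1), x ! \<pi> n]"
    using rep by (auto simp: proper_representation_def)
  have n: "n \<ge> 3" using completely_reducible_arity[OF h1] by simp
  obtain y z where yq: "\<And>i. i < q \<Longrightarrow> y i < q" and zq: "\<And>i. i < q \<Longrightarrow> z i < q"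
    and h2: "\<And>i. i < q \<Longrightarrow> h2 [y i, z i] = i" and y: "inj_on y {..<q}" and z: "inj_on z {..<q}"
    using transversal_binaryE[OF T] by blast
  obtain E where E: "rooted q (n - 1) h1 0 E" using completely_reducible_rooted[OF h1] by blast
  have vE: "vars E = {1..n - 1}" using E by (auto simp: rooted_def)
  \<comment> \<open>The \<open>i\<close>-th tuple is listed first in the order of the
    representation, where argument \<open>k\<close> of \<open>h1\<close> is variable
    \<open>Suc k\<close> of \<open>E\<close>. Then \<open>w\<close> moves the entries to their
    original positions through \<open>inv \<pi>\<close>.\<close>
  define u where "u X i k = (if k < n - 1 then X (Suc k) i else if k = n - 1 then y i else z i)"
    for X :: "nat \<Rightarrow> nat \<Rightarrow> nat" and i k
  define w where "w X i = map (\<lambda>j. u X i (inv \<pi> j)) [0..<n + 1]" for X i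
  have inv_le: "inv \<pi> j \<le> n" if "j \<le> n" for j
    using permutes_in_image[OF permutes_inv[OF \<pi>], of j] that by simp
  have w: "w X i ! j = u X i (inv \<pi> j)" if "j \<le> n" for X i j
    using that by (simp add: w_def del: upt_Suc)
  have w\<pi>: "w X i ! \<pi> k = u X i k" if "k \<le> n" for X i k
    using w[of "\<pi> k"] permutes_in_image[OF \<pi>, of k] permutes_inverses(2)[OF \<pi>] that by simp
  have uq: "u X i k < q" if "X \<in> families q E (\<lambda>i. i)" "i < q" for X i k
    using families_less[OF that(1), of "Suc k" i] that yq zq by (auto simp: u_def vE)
  have wq: "w X i \<in> vecs q (n + 1)" if "X \<in> families q E (\<lambda>i. i)" "i < q" for X i
    unfolding w_def using uq[OF that] by (intro vecs_map) auto
  have "card (families q E (\<lambda>i. i)) \<le> card {T. transversal q n f T}"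
  \<comment> \<open>Coordinate \<open>\<pi> n\<close> carries \<open>z i\<close> for every family
    \<open>X\<close>, so it reveals the index of a tuple.\<close>
  proof (rule card_le_transversals[where w = w and k = "\<pi> n" and p = z])
    fix X i assume X: "X \<in> families q E (\<lambda>i. i)" "i < q"
    show "w X i \<in> vecs q (n + 1)" using X by (rule wq)
    have "map (\<lambda>k. w X i ! \<pi> k) [0..<n - 1] = map (\<lambda>v. X v i) [1..<n - 1 + 1]"
      by (rule nth_equalityI) (auto simp: w\<pi> u_def simp del: upt_Suc)
    then have "h1 (map (\<lambda>k. w X i ! \<pi> k) [0..<n - 1]) = i"
      using rooted_families(2)[OF E X] by simp
    moreover have "h2 [w X i ! \<pi> (n - 1), w X i ! \<pi> n] = i"
      using h2[OF X(2)] n w\<pi>[of "n - 1" X i] w\<pi>[of n X i] by (auto simp: u_def)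
    ultimately show "w X i ! 0 = f (tl (w X i))" using f[OF wq[OF X]] by simp
    show "w X i ! \<pi> n = z i" using n w\<pi>[of n X i] by (auto simp: u_def)
  next
    fix X j assume X: "X \<in> families q E (\<lambda>i. i)" and j: "j \<le> n"
    have "inj_on (\<lambda>i. u X i k) {..<q}" if "k \<le> n" for k
    proof -
      consider "k < n - 1" | "k = n - 1" | "\<not> k < n - 1" "k \<noteq> n - 1" by blast
      then show ?thesis
        using families_inj[OF X, of "Suc k" "{..<q}"] y z
        by cases (simp_all add: u_def vE)
    qed
    then show "inj_on (\<lambda>i. w X i ! j) {..<q}" using w[OF j] inv_le[OF j] by simp
  next
    show "\<pi> n \<le> n" using permutes_in_image[OF \<pi>, of n] by simp
  next
    fix X Y assume XY: "X \<in> families q E (\<lambda>i. i)" "Y \<in> families q E (\<lambda>i. i)"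
      "\<And>i. i < q \<Longrightarrow> w X i = w Y i"
    show "X = Y"
    proof (rule families_ext[OF XY(1,2)])
      fix v i assume v: "v \<in> vars E" and i: "i < q"
      then have "u X i (v - 1) = u Y i (v - 1)"
        using XY(3)[OF i] w\<pi>[of "v - 1"] by (metis vE atLeastAtMost_iff diff_le_self le_trans)
      then show "X v i = Y v i" using v by (auto simp: u_def vE split: if_splits)
    qed
  qed
  \<comment> \<open>For even \<open>n\<close> rounding down absorbs the loss of one variable in
    passing from \<open>f\<close> to \<open>h1\<close>.\<close>
  moreover have "(n - 1 - 1) div 2 = (n - 1) div 2" "odd (n - 1)"
    using \<open>even n\<close> n by presburger+
  ultimately show ?thesis using card_families_rooted[OF E] by simp
qed

theorem theorem7:
  fixes q n :: nat and f :: "nat list \<Rightarrow> nat"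
  assumes "completely_reducible q n f"
  shows "(odd n \<longrightarrow>
            card {T. transversal q n f T} \<ge> (q * fact q) ^ ((n - 1) div 2)) \<and>
         (even n \<and>
          (\<exists>\<pi> h1 h2. proper_representation q n f \<pi> h1 h2 \<and> (\<exists>T. transversal q 2 h2 T)) \<longrightarrow>
            card {T. transversal q n f T} \<ge> (q * fact q) ^ ((n - 1) div 2))"
  using transversals_odd[OF assms] transversals_even by blast

end
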